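(* Let $f(X)\in\mathbb{F}_2[[X]]$ be a formal power series with coefficients in $\mathbb{F}_2$. Suppose there exist an integer $m\ge 1$, polynomials $P_1(X),\dots,P_m(X)\in\mathbb{F}_2[X]$ and positive integers $r_1,\dots,r_m$ and $l_1,\dots,l_m$ such that for every $1\le j\le m$, either $$f(X)=\frac{P_j(X)}{(1+X)^{l_j}+X^{r_j}}\qquad\text{or}\qquad f(X)=\frac{P_j(X)}{X^{r_j}(1+X)^{l_j}+1}.$$ Let $l=\gcd(l_1,\dots,l_m)$. Then there exist a polynomial $P(X)\in\mathbb{F}_2[X]$ and an integer $r\ge 1$ such that either $$f(X)=\frac{P(X)}{(1+X)^l+X^r}\qquad\text{or}\qquad f(X)=\frac{P(X)}{X^r(1+X)^l+1}.$$
   Context: An equality $f=P/D$ with $P,D\in\mathbb{F}_2[X]$ means $D(X)f(X)=P(X)$ in $\mathbb{F}_2[[X]]$. *)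

theory Defs
  imports "HOL-Library.Z2" "HOL-Computational_Algebra.Polynomial_FPS"
begin

text \<open>The field with two elements is the type \<^typ>\<open>bit\<close>; a fraction of polynomials is read
  as a multiplicative identity in the ring of formal power series.\<close>

definition fps_eq_frac :: "'a::comm_ring_1 fps \<Rightarrow> 'a poly \<Rightarrow> 'a poly \<Rightarrow> bool" where
  "fps_eq_frac f P D \<longleftrightarrow> fps_of_poly D * f = fps_of_poly P"

abbreviation polyX :: "'a::comm_ring_1 poly" where
  "polyX \<equiv> monom 1 1"

end

theory Submission imports Defs begin

text \<open>The polynomials \<open>D\<close> for which \<open>D f\<close> is a polynomial form an ideal; we compute modulo this
  ideal, over the field with two elements. Either shape of denominator says that the \<open>l j\<close>-th power
  of \<open>Y = 1 + X\<close> is congruent to a power of \<open>X\<close>, possibly with negative exponent. Each of these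
  denominators has a nonzero constant term, so by finiteness \<open>X\<close> has finite multiplicative order,
  and then so does \<open>Y\<close>. Hence the exponents \<open>n\<close> for which \<open>Y^n\<close> is congruent to a power of \<open>X\<close> are
  closed under sums and differences, and therefore contain the gcd of the \<open>l j\<close>.\<close>

definition cong_denom :: "'a::comm_ring_1 fps \<Rightarrow> 'a poly \<Rightarrow> 'a poly \<Rightarrow> bool" where
  "cong_denom f a b \<longleftrightarrow> (\<exists>P. fps_eq_frac f P (a - b))"

lemma cong_denom_refl [simp]: "cong_denom f a a"
  unfolding cong_denom_def fps_eq_frac_def by (intro exI[of _ 0]) simp

lemma cong_denom_sym:
  assumes "cong_denom f a b"
  shows "cong_denom f b a"
proof -
  obtain P where "fps_of_poly (a - b) * f = fps_of_poly P"
    using assms unfolding cong_denom_def fps_eq_frac_def by blast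
  then have "fps_of_poly (b - a) * f = fps_of_poly (- P)"
    by (simp add: fps_of_poly_diff fps_of_poly_uminus algebra_simps)
  then show ?thesis
    unfolding cong_denom_def fps_eq_frac_def by blast
qed

lemma cong_denom_trans [trans]:
  assumes "cong_denom f a b" "cong_denom f b c"
  shows "cong_denom f a c"
proof -
  obtain P Q where "fps_of_poly (a - b) * f = fps_of_poly P" "fps_of_poly (b - c) * f = fps_of_poly Q"
    using assms unfolding cong_denom_def fps_eq_frac_def by blast
  moreover have "a - c = (a - b) + (b - c)"
    by simp
  ultimately have "fps_of_poly (a - c) * f = fps_of_poly (P + Q)"
    by (simp only: fps_of_poly_add distrib_right)
  then show ?thesis
    unfolding cong_denom_def fps_eq_frac_def by blast
qed

lemma cong_denom_mult_left:
  assumes "cong_denom f a b"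
  shows "cong_denom f (c * a) (c * b)"
proof -
  obtain P where "fps_of_poly (a - b) * f = fps_of_poly P"
    using assms unfolding cong_denom_def fps_eq_frac_def by blast
  then have "fps_of_poly (c * a - c * b) * f = fps_of_poly (c * P)"
    by (simp only: right_diff_distrib[symmetric] fps_of_poly_mult mult.assoc)
  then show ?thesis
    unfolding cong_denom_def fps_eq_frac_def by blast
qed

lemma cong_denom_mult:
  assumes "cong_denom f a b" "cong_denom f c d"
  shows "cong_denom f (a * c) (b * d)"
  using cong_denom_mult_left[OF assms(2), of a] cong_denom_mult_left[OF assms(1), of d]
  by (metis cong_denom_trans mult.commute)

lemma cong_denom_power:
  "cong_denom f a b \<Longrightarrow> cong_denom f (a ^ n) (b ^ n)"
  by (induction n) (auto intro: cong_denom_mult)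

lemma cong_denom_power_1:
  "cong_denom f a 1 \<Longrightarrow> cong_denom f (a ^ n) 1"
  using cong_denom_power[of f a 1 n] by simp

lemma cong_denom_if_dvd:
  assumes "fps_eq_frac f P D" "D dvd a - b"
  shows "cong_denom f a b"
proof -
  obtain E where "a - b = E * D"
    using assms(2) by (metis dvd_def mult.commute)
  then have "fps_of_poly (a - b) * f = fps_of_poly (E * P)"
    using assms(1) by (simp add: fps_eq_frac_def fps_of_poly_mult mult.assoc)
  then show ?thesis
    unfolding cong_denom_def fps_eq_frac_def by blast
qed

lemma finite_polys_degree_le:
  "finite {p :: 'a::{finite,zero} poly. degree p \<le> n}"
proof (rule finite_subset)
  show "finite (Poly ` {xs :: 'a list. set xs \<subseteq> UNIV \<and> length xs \<le> Suc n})"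
    by (intro finite_imageI finite_lists_length_le) simp
  show "{p :: 'a poly. degree p \<le> n} \<subseteq> Poly ` {xs. set xs \<subseteq> UNIV \<and> length xs \<le> Suc n}"
  proof
    fix p :: "'a poly"
    assume "p \<in> {p. degree p \<le> n}"
    then have "length (coeffs p) \<le> Suc n"
      by (cases "p = 0") (auto simp: length_coeffs_degree)
    then show "p \<in> Poly ` {xs. set xs \<subseteq> UNIV \<and> length xs \<le> Suc n}"
      by (intro image_eqI[of _ _ "coeffs p"]) auto
  qed
qed

text \<open>Write \<open>polyX * E = D * Q\<close> and evaluate at 0: the left side vanishes and
  \<open>D\<close> does not, so \<open>Q\<close> has zero constant term. Thus X divides
  \<open>Q\<close> and can be cancelled from both sides.\<close>

lemma dvd_polyX_mult_cancel:
  fixes D E :: "'a::field poly"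
  assumes "D dvd polyX * E" "coeff D 0 \<noteq> 0"
  shows "D dvd E"
proof -
  obtain Q where Q: "polyX * E = D * Q"
    using assms(1) by blast
  have X: "(polyX :: 'a poly) = [:0, 1:]"
    by (simp add: monom_altdef)
  have "poly D 0 * poly Q 0 = poly (polyX * E) 0"
    unfolding Q by simp
  also have "\<dots> = 0"
    by (simp add: poly_monom)
  finally have "poly Q 0 = 0"
    using assms(2) by (simp add: poly_0_coeff_0)
  then obtain Q' where "Q = polyX * Q'"
    unfolding X by (auto simp: poly_eq_0_iff_dvd)
  then have "polyX * E = polyX * (D * Q')"
    using Q by (simp add: algebra_simps)
  then have "E = D * Q'"
    by simp
  then show ?thesis
    by simp
qed

lemma dvd_polyX_power_mult_cancel:
  fixes D E :: "'a::field poly"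
  assumes "D dvd polyX ^ n * E" "coeff D 0 \<noteq> 0"
  shows "D dvd E"
  using assms(1)
proof (induction n)
  case (Suc n)
  then have "D dvd polyX * (polyX ^ n * E)"
    by (simp only: power_Suc mult.assoc)
  then show ?case
    using Suc.IH dvd_polyX_mult_cancel assms(2) by blast
qed simp

text \<open>Pigeonhole: the powers of X leave only finitely many remainders modulo \<open>D\<close>,
  so two of them agree. The smaller power cancels because X does not divide
  \<open>D\<close>.\<close>

lemma exists_dvd_polyX_power_minus_1:
  fixes D :: "'a::{finite,field} poly"
  assumes "coeff D 0 \<noteq> 0"
  shows "\<exists>N\<ge>1. D dvd polyX ^ N - 1"
proof -
  have "degree (p mod D) \<le> degree D" for p
    using degree_mod_less[of D p] assms by fastforce
  then have "range (\<lambda>n. polyX ^ n mod D) \<subseteq> {p. degree p \<le> degree D}"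
    by auto
  then have "finite (range (\<lambda>n. polyX ^ n mod D))"
    using finite_polys_degree_le finite_subset by blast
  then have "\<not> inj (\<lambda>n. polyX ^ n mod D :: 'a poly)"
    using finite_imageD infinite_UNIV_nat by blast
  then obtain a b where "a < b" and ab: "polyX ^ b mod D = polyX ^ a mod D"
    by (auto simp: inj_def elim!: linorder_neqE_nat)
  have "D dvd polyX ^ b - polyX ^ a"
    using ab by (simp only: mod_eq_dvd_iff)
  also have "polyX ^ b - polyX ^ a = (polyX ^ a * (polyX ^ (b - a) - 1) :: 'a poly)"
    using \<open>a < b\<close> by (simp add: right_diff_distrib flip: power_add)
  finally have "D dvd polyX ^ a * (polyX ^ (b - a) - 1)" .
  then have "D dvd polyX ^ (b - a) - 1"
    using assms by (rule dvd_polyX_power_mult_cancel)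
  then show ?thesis
    using \<open>a < b\<close> by (intro exI[of _ "b - a"]) auto
qed

text \<open>Bezout over the naturals writes the gcd as a difference of a multiple of
  \<open>a\<close> and a multiple of \<open>b\<close>, so subtraction is only ever needed
  downwards.\<close>

lemma gcd_in_additive_set:
  fixes S :: "nat set"
  assumes add: "\<And>a b. a \<in> S \<Longrightarrow> b \<in> S \<Longrightarrow> a + b \<in> S"
    and diff: "\<And>a b. a \<in> S \<Longrightarrow> b \<in> S \<Longrightarrow> b \<le> a \<Longrightarrow> a - b \<in> S"
    and "a \<in> S" "b \<in> S"
  shows "gcd a b \<in> S"
proof (cases "a = 0")
  case False
  \<comment> \<open>The base case, that 0 lies in \<open>S\<close>, comes from
    \<open>c - c\<close>.\<close>
  have mult: "k * c \<in> S" if "c \<in> S" for k c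
    using diff[OF that that] by (induction k) (auto intro: add that)
  obtain x y where xy: "a * x = b * y + gcd a b"
    using bezout_nat[OF False] by blast
  have "x * a - y * b \<in> S"
    using xy by (intro diff mult assms(3,4)) (simp add: mult.commute)
  then show ?thesis
    using xy by (simp add: mult.commute)
qed (simp add: assms(4))

lemma Gcd_in_additive_set:
  fixes S A :: "nat set"
  assumes "\<And>a b. a \<in> S \<Longrightarrow> b \<in> S \<Longrightarrow> a + b \<in> S"
    and "\<And>a b. a \<in> S \<Longrightarrow> b \<in> S \<Longrightarrow> b \<le> a \<Longrightarrow> a - b \<in> S"
    and "finite A" "A \<noteq> {}" "A \<subseteq> S"
  shows "Gcd A \<in> S"
  using assms(3-5) by (induction A rule: finite_ne_induct) (auto intro: gcd_in_additive_set assms(1,2))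

instance bit :: finite
proof
  have "(UNIV :: bit set) = {0, 1}"
    using bit_not_one_iff by blast
  then show "finite (UNIV :: bit set)"
    by (metis finite.emptyI finite.insertI)
qed

text \<open>Characteristic 2 lets the sums in the two denominator shapes be read as the differences
  in \<open>cong_denom\<close>.\<close>

lemma bit_poly_minus_eq_add: "a - b = a + (b :: bit poly)"
  by (simp add: poly_eq_iff)

theorem theorem4:
  fixes f :: "bit fps" and m :: nat and P :: "nat \<Rightarrow> bit poly" and r l :: "nat \<Rightarrow> nat"
  assumes "m \<ge> 1"
    and "\<And>j. j \<in> {1..m} \<Longrightarrow> r j > 0"
    and "\<And>j. j \<in> {1..m} \<Longrightarrow> l j > 0"
    and "\<And>j. j \<in> {1..m} \<Longrightarrow>
           fps_eq_frac f (P j) ((1 + polyX) ^ l j + polyX ^ r j) \<or>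
           fps_eq_frac f (P j) (polyX ^ r j * (1 + polyX) ^ l j + 1)"
  shows "\<exists>(Q :: bit poly) (s :: nat). s \<ge> 1 \<and>
           (fps_eq_frac f Q ((1 + polyX) ^ (GCD j\<in>{1..m}. l j) + polyX ^ s) \<or>
            fps_eq_frac f Q (polyX ^ s * (1 + polyX) ^ (GCD j\<in>{1..m}. l j) + 1))"
proof -
  let ?X = "polyX :: bit poly"
  define Y where "Y = 1 + ?X"
  \<comment> \<open>The exponent \<open>k\<close> is a natural number, possibly 0; negative powers
    of X will be made nonnegative by means of the order of X.\<close>
  define S where "S = {n. \<exists>k. cong_denom f (Y ^ n) (?X ^ k)}"
  obtain D P\<^sub>1 where D: "fps_eq_frac f P\<^sub>1 D"
      "D = Y ^ l 1 + ?X ^ r 1 \<or> D = ?X ^ r 1 * Y ^ l 1 + 1"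
    using assms(4)[of 1] assms(1) unfolding Y_def by auto
  \<comment> \<open>At 0 the value of \<open>Y\<close> is 1, and the power of X vanishes because
    \<open>r 1 > 0\<close>; this covers both shapes.\<close>
  have "poly D 0 = 1"
    using D(2) assms(1) assms(2)[of 1] by (auto simp: Y_def poly_monom)
  then obtain N where "N \<ge> 1" "D dvd ?X ^ N - 1"
    using exists_dvd_polyX_power_minus_1[of D] by (auto simp: poly_0_coeff_0)
  then have X: "cong_denom f (?X ^ N) 1"
    using cong_denom_if_dvd D(1) by blast
  have l_in_S: "l j \<in> S" if "j \<in> {1..m}" for j
    using assms(4)[OF that]
  proof
    assume "fps_eq_frac f (P j) ((1 + polyX) ^ l j + polyX ^ r j)"
    then show ?thesis
      unfolding S_def Y_def cong_denom_def bit_poly_minus_eq_add by blast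
  next
    assume "fps_eq_frac f (P j) (polyX ^ r j * (1 + polyX) ^ l j + 1)"
    then have 1: "cong_denom f (?X ^ r j * Y ^ l j) 1"
      unfolding Y_def cong_denom_def bit_poly_minus_eq_add by blast
    \<comment> \<open>Here \<open>Y ^ l j\<close> is inverse to \<open>?X ^ r j\<close>. Since
      \<open>?X ^ N\<close> is congruent to 1, that inverse is represented by
      \<open>?X ^ ((N - 1) * r j)\<close>.\<close>
    have "cong_denom f (1 * Y ^ l j) ((?X ^ N) ^ r j * Y ^ l j)"
      by (intro cong_denom_mult cong_denom_sym[OF cong_denom_power_1[OF X]] cong_denom_refl)
    also have "(?X ^ N) ^ r j * Y ^ l j = ?X ^ ((N - 1) * r j) * (?X ^ r j * Y ^ l j)"
    proof -
      have "N * r j = (N - 1) * r j + r j"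
        using \<open>N \<ge> 1\<close> by (cases N) simp_all
      then show ?thesis
        by (simp only: power_mult[symmetric] power_add mult.assoc)
    qed
    also have "cong_denom f \<dots> (?X ^ ((N - 1) * r j) * 1)"
      by (rule cong_denom_mult_left[OF 1])
    finally have "cong_denom f (Y ^ l j) (?X ^ ((N - 1) * r j))"
      by simp
    then show ?thesis
      unfolding S_def by blast
  qed
  \<comment> \<open>Some power of \<open>Y\<close> is congruent to a power of X, whose
    \<open>N\<close>-th power is congruent to 1; so \<open>M = l 1 * N\<close> works.\<close>
  obtain M where "M \<ge> 1" and Y: "cong_denom f (Y ^ M) 1"
  proof -
    obtain k where "cong_denom f (Y ^ l 1) (?X ^ k)"
      using l_in_S[of 1] assms(1) unfolding S_def by auto
    then have "cong_denom f ((Y ^ l 1) ^ N) ((?X ^ k) ^ N)"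
      by (rule cong_denom_power)
    moreover have "cong_denom f ((?X ^ k) ^ N) 1"
      using cong_denom_power_1[OF X, of k] by (simp add: mult.commute flip: power_mult)
    ultimately have "cong_denom f (Y ^ (l 1 * N)) 1"
      by (metis cong_denom_trans power_mult)
    moreover have "l 1 * N \<ge> 1"
      using \<open>N \<ge> 1\<close> assms(1) assms(3)[of 1] by (simp add: Suc_le_eq)
    ultimately show ?thesis
      using that by blast
  qed
  have add: "a + b \<in> S" if ab: "a \<in> S" "b \<in> S" for a b
  proof -
    obtain i k where "cong_denom f (Y ^ a) (?X ^ i)" "cong_denom f (Y ^ b) (?X ^ k)"
      using ab unfolding S_def by blast
    then have "cong_denom f (Y ^ (a + b)) (?X ^ (i + k))"
      unfolding power_add by (rule cong_denom_mult)
    then show ?thesis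
      unfolding S_def by blast
  qed
  have diff: "a - b \<in> S" if ab: "a \<in> S" "b \<in> S" "b \<le> a" for a b
  proof -
    obtain i k where i: "cong_denom f (Y ^ a) (?X ^ i)" and k: "cong_denom f (Y ^ b) (?X ^ k)"
      using ab unfolding S_def by blast
    \<comment> \<open>Division by \<open>Y ^ b\<close> becomes multiplication by
      \<open>(Y ^ b) ^ (M - 1)\<close>, which is again congruent to a power of X.\<close>
    have "cong_denom f (Y ^ (a - b) * 1) (Y ^ (a - b) * (Y ^ M) ^ b)"
      by (intro cong_denom_mult_left cong_denom_sym[OF cong_denom_power_1[OF Y]])
    also have "Y ^ (a - b) * (Y ^ M) ^ b = Y ^ a * (Y ^ b) ^ (M - 1)"
    proof -
      have "a - b + M * b = a + b * (M - 1)"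
        using \<open>b \<le> a\<close> \<open>M \<ge> 1\<close> by (cases M) (simp_all add: algebra_simps)
      then show ?thesis
        by (simp flip: power_mult power_add)
    qed
    also have "cong_denom f (Y ^ a * (Y ^ b) ^ (M - 1)) (?X ^ i * (?X ^ k) ^ (M - 1))"
      by (intro cong_denom_mult cong_denom_power i k)
    also have "?X ^ i * (?X ^ k) ^ (M - 1) = ?X ^ (i + k * (M - 1))"
      by (simp add: power_add power_mult)
    finally show ?thesis
      unfolding S_def by auto
  qed
  have "(GCD j\<in>{1..m}. l j) \<in> S"
    using l_in_S assms(1) by (intro Gcd_in_additive_set add diff) auto
  then obtain k where "cong_denom f (Y ^ (GCD j\<in>{1..m}. l j)) (?X ^ k)"
    unfolding S_def by blast
  \<comment> \<open>As \<open>k\<close> may be 0, adding the period \<open>N\<close> ensures a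
    positive exponent. The result always has the first of the two shapes.\<close>
  also have "cong_denom f (?X ^ k) (?X ^ (k + N))"
    using cong_denom_sym[OF cong_denom_mult_left[OF X, of "?X ^ k"]] by (simp add: power_add)
  finally obtain Q where "fps_eq_frac f Q (Y ^ (GCD j\<in>{1..m}. l j) + ?X ^ (k + N))"
    unfolding cong_denom_def bit_poly_minus_eq_add by blast
  then show ?thesis
    using \<open>N \<ge> 1\<close> unfolding Y_def by (intro exI[of _ Q] exI[of _ "k + N"]) simp
qed

end
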